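(* Let $C$ be a global constraint over sequences of variables, and let $C_{app}$ be the tightest contractible approximation of $C$, i.e. the constraint whose language is $L_{C_{app}} = P(L_C)$. Suppose we have closed propagators for $C_{app}$ and for $C$ that each maintain domain consistency for the sequence $\vec{X}$. Then Bart\'{a}k's proposal (run the propagator for $C_{app}$, extended to accept additional variables appended to the right-hand end of $\vec{X}$, for as long as the constraint is open; once $\vec{X}$ is closed, replace it by the closed propagator for $C$) maintains open D-consistency for $C$.
   Context: A global constraint $C$ is a relation on a single sequence of variables $\vec{X}=[X_1,\ldots,X_n]$ (of any length $n$); its semantics is the formal language $L_C$, where a word $d_1\cdots d_n\in L_C$ iff $X_1=d_1,\ldots,X_n=d_n$ is a solution of $C([X_1,\ldots,X_n])$. For a language $L$, $P(L)=\{w \mid \exists u\; wu\in L\}$ is its prefix-closure. An open constraint is one to which variables may be added at the right-hand end of its sequence until it is declared closed; an occurrence of the constraint is its state at some point of execution. Each variable $X$ has a domain $D(X)$ of values. A closed constraint $C(X_1,\ldots,X_n)$ is domain consistent if for every $i$ and every $d\in D(X_i)$ there is a word $d_1\cdots d_n\in L_C$ with $d_i=d$ and $d_j\in D(X_j)$ for all $j$. An occurrence of $C(\vec{X})$ is open D-consistent if for every $X_i\in\vec{X}$ and every $d\in D(X_i)$ there is a word $d_1\cdots d_m\in L_C$ with $d_i=d$, $|\vec{X}|\le m$, and $d_j\in D(X_j)$ for $j=1,\ldots,|\vec{X}|$. *)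

theory Defs
  imports Main
begin

section \<open>Closed constraints\<close>

text \<open>A global constraint is identified with its language, a set of words over the type of values;
  posted on a sequence of variables, only the words of the length of that sequence matter.\<close>

type_synonym 'a constraint = "'a list set"
type_synonym ('v, 'a) domain = "'v \<Rightarrow> 'a set"

definition prefix_closure :: "'a list set \<Rightarrow> 'a list set" where
  "prefix_closure L = {w. \<exists>u. w @ u \<in> L}"

definition tightest_contractible_approx :: "'a constraint \<Rightarrow> 'a constraint" where
  "tightest_contractible_approx C = prefix_closure C"

text \<open>Positions are counted from 0. Nothing forces the variables in a sequence to be distinct.\<close>

definition domain_consistent :: "'a constraint \<Rightarrow> 'v list \<Rightarrow> ('v, 'a) domain \<Rightarrow> bool" where
  "domain_consistent C X D \<longleftrightarrow>
     (\<forall>i < length X. \<forall>d \<in> D (X ! i).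
        \<exists>w \<in> C. length w = length X \<and> w ! i = d \<and> (\<forall>j < length X. w ! j \<in> D (X ! j)))"

definition solutions :: "'a constraint \<Rightarrow> 'v list \<Rightarrow> ('v, 'a) domain \<Rightarrow> ('v \<Rightarrow> 'a) set" where
  "solutions C X D = {\<sigma>. map \<sigma> X \<in> C \<and> (\<forall>x \<in> set X. \<sigma> x \<in> D x)}"

text \<open>A domain transformer that only removes values, only from the variables of the given
  sequence.\<close>

definition filters :: "'v list \<Rightarrow> ('v, 'a) domain \<Rightarrow> ('v, 'a) domain \<Rightarrow> bool" where
  "filters X D D' \<longleftrightarrow> (\<forall>x. D' x \<subseteq> D x) \<and> (\<forall>x. x \<notin> set X \<longrightarrow> D' x = D x)"

text \<open>Without the requirement that no solution is lost, emptying all domains would count as a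
  propagator and would vacuously establish every consistency condition.\<close>

definition closed_propagator ::
    "'a constraint \<Rightarrow> 'v list \<Rightarrow> (('v, 'a) domain \<Rightarrow> ('v, 'a) domain) \<Rightarrow> bool" where
  "closed_propagator C X p \<longleftrightarrow>
     (\<forall>D. filters X D (p D) \<and> solutions C X D \<subseteq> solutions C X (p D))"

definition maintains_domain_consistency ::
    "'a constraint \<Rightarrow> 'v list \<Rightarrow> (('v, 'a) domain \<Rightarrow> ('v, 'a) domain) \<Rightarrow> bool" where
  "maintains_domain_consistency C X p \<longleftrightarrow> (\<forall>D. domain_consistent C X (p D))"


section \<open>Open constraints\<close>

record ('v, 'a) occurrence =
  vars :: "'v list"
  is_closed :: bool
  doms :: "('v, 'a) domain"

definition open_D_consistent :: "'a constraint \<Rightarrow> ('v, 'a) occurrence \<Rightarrow> bool" where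
  "open_D_consistent C s \<longleftrightarrow>
     (\<forall>i < length (vars s). \<forall>d \<in> doms s (vars s ! i).
        \<exists>w \<in> C. length (vars s) \<le> length w \<and> w ! i = d \<and>
          (\<forall>j < length (vars s). w ! j \<in> doms s (vars s ! j)))"

text \<open>While the constraint is open, an assignment to the present variables is still viable if
  some further values (for variables yet to be appended) complete it to a word of the language;
  after closing, it has to be a solution itself.\<close>

definition viable :: "'a constraint \<Rightarrow> ('v, 'a) occurrence \<Rightarrow> ('v \<Rightarrow> 'a) set" where
  "viable C s =
     {\<sigma>. (if is_closed s then map \<sigma> (vars s) \<in> C else \<exists>u. map \<sigma> (vars s) @ u \<in> C) \<and>
         (\<forall>x \<in> set (vars s). \<sigma> x \<in> doms s x)}"

text \<open>Changes to an occurrence that are not made by its own propagator: domain reductions from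
  elsewhere, variables appended at the right-hand end, and closing.\<close>

inductive change :: "('v, 'a) occurrence \<Rightarrow> ('v, 'a) occurrence \<Rightarrow> bool" where
  restrict: "(\<And>x. D' x \<subseteq> doms s x) \<Longrightarrow> change s (s\<lparr>doms := D'\<rparr>)"
| append: "\<not> is_closed s \<Longrightarrow> change s (s\<lparr>vars := vars s @ Y\<rparr>)"
| close: "\<not> is_closed s \<Longrightarrow> change s (s\<lparr>is_closed := True\<rparr>)"

type_synonym ('v, 'a) open_propagator = "('v, 'a) occurrence \<Rightarrow> ('v, 'a) domain"

definition propagate ::
    "('v, 'a) open_propagator \<Rightarrow> ('v, 'a) occurrence \<Rightarrow> ('v, 'a) occurrence" where
  "propagate q s = s\<lparr>doms := q s\<rparr>"

text \<open>The occurrences on which the propagator q is invoked when the constraint is initially posted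
  as open on X, with arbitrary domains. Any number of changes may happen between two invocations.\<close>

inductive invoked ::
    "('v, 'a) open_propagator \<Rightarrow> 'v list \<Rightarrow> ('v, 'a) occurrence \<Rightarrow> bool"
  for q X where
  post: "invoked q X \<lparr>vars = X, is_closed = False, doms = D\<rparr>"
| step: "invoked q X s \<Longrightarrow> change\<^sup>*\<^sup>* (propagate q s) s' \<Longrightarrow> invoked q X s'"

definition maintains_open_D_consistency ::
    "'a constraint \<Rightarrow> 'v list \<Rightarrow> ('v, 'a) open_propagator \<Rightarrow> bool" where
  "maintains_open_D_consistency C X q \<longleftrightarrow>
     (\<forall>s. invoked q X s \<longrightarrow>
        filters (vars s) (doms s) (q s) \<and>
        viable C s \<subseteq> viable C (propagate q s) \<and>
        open_D_consistent C (propagate q s))"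

text \<open>Propagators given for every sequence of variables, so that the one for the approximation can
  follow the sequence as it grows.\<close>

definition bartak ::
    "('v list \<Rightarrow> ('v, 'a) domain \<Rightarrow> ('v, 'a) domain) \<Rightarrow>
     ('v list \<Rightarrow> ('v, 'a) domain \<Rightarrow> ('v, 'a) domain) \<Rightarrow> ('v, 'a) open_propagator" where
  "bartak p_app p s =
     (if is_closed s then p (vars s) (doms s) else p_app (vars s) (doms s))"

end

theory Submission
  imports Defs
begin

text \<open>At every invocation, \<open>bartak\<close> acts as a closed propagator for one language:
  \<open>prefix_closure C\<close> while open, \<open>C\<close> once closed. By
  \<open>viable_eq_solutions\<close>, the solutions for that language are exactly the viable
  assignments, so none are lost. For consistency, a support in \<open>prefix_closure C\<close> is a
  prefix of a word of \<open>C\<close>, and this longer word is an open support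
  (\<open>open_D_consistent_if_approx_domain_consistent\<close>). The closed phase reduces to the
  same argument because \<open>C\<close> lies inside its prefix-closure.\<close>

lemma change_appends: "change s s' \<Longrightarrow> \<exists>Y. vars s' = vars s @ Y"
  by (induction rule: change.induct) auto

lemma changes_append: "change\<^sup>*\<^sup>* s s' \<Longrightarrow> \<exists>Y. vars s' = vars s @ Y"
proof (induction rule: rtranclp_induct)
  case base
  show ?case by simp
next
  case (step t u)
  then show ?case using change_appends[of t u] by auto
qed

text \<open>Propagation and restriction touch only domains, closing only the flag, and appending
  only the right-hand end. Hence hypotheses about all sequences \<open>X @ Y\<close> apply at every
  invocation.\<close>

lemma invoked_appends: "invoked q X s \<Longrightarrow> \<exists>Y. vars s = X @ Y"
proof (induction rule: invoked.induct)
  case (post D)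
  show ?case by simp
next
  case (step s s')
  then show ?case using changes_append[of "propagate q s" s'] by (auto simp: propagate_def)
qed

text \<open>The completion \<open>u\<close> in the open case of \<open>viable\<close> is precisely
  the witness for membership in the prefix-closure.\<close>

lemma viable_eq_solutions:
  "viable C s =
     solutions (if is_closed s then C else tightest_contractible_approx C) (vars s) (doms s)"
  by (auto simp: viable_def solutions_def tightest_contractible_approx_def prefix_closure_def)

lemma prefix_closure_superset: "C \<subseteq> prefix_closure C"
  unfolding prefix_closure_def by (auto intro: exI[of _ "[]"])

lemma domain_consistent_mono:
  "domain_consistent C X D \<Longrightarrow> C \<subseteq> C' \<Longrightarrow> domain_consistent C' X D"
  unfolding domain_consistent_def by blast

lemma open_D_consistent_if_approx_domain_consistent:
  assumes "domain_consistent (tightest_contractible_approx C) (vars s) (doms s)"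
  shows "open_D_consistent C s"
  unfolding open_D_consistent_def
proof (intro allI impI ballI)
  fix i d
  assume i: "i < length (vars s)" and "d \<in> doms s (vars s ! i)"
  then obtain w u where "w @ u \<in> C" "length w = length (vars s)" "w ! i = d"
    "\<forall>j < length (vars s). w ! j \<in> doms s (vars s ! j)"
    using assms
    unfolding domain_consistent_def tightest_contractible_approx_def prefix_closure_def
    by blast
  with i show "\<exists>w \<in> C. length (vars s) \<le> length w \<and> w ! i = d \<and>
      (\<forall>j < length (vars s). w ! j \<in> doms s (vars s ! j))"
    \<comment> \<open>Appending \<open>u\<close> leaves the first \<open>length (vars s)\<close>
      positions unchanged, and both \<open>i\<close> and every \<open>j\<close> lie among
      them.\<close>
    by (intro bexI[of _ "w @ u"]) (auto simp: nth_append)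
qed

theorem theorem1:
  fixes C :: "'a constraint"
    and X :: "'v list"
    and p_app p :: "'v list \<Rightarrow> ('v, 'a) domain \<Rightarrow> ('v, 'a) domain"
  assumes "\<And>Y. closed_propagator (tightest_contractible_approx C) (X @ Y) (p_app (X @ Y))"
    and "\<And>Y. maintains_domain_consistency (tightest_contractible_approx C) (X @ Y) (p_app (X @ Y))"
    and "\<And>Y. closed_propagator C (X @ Y) (p (X @ Y))"
    and "\<And>Y. maintains_domain_consistency C (X @ Y) (p (X @ Y))"
  shows "maintains_open_D_consistency C X (bartak p_app p)"
  unfolding maintains_open_D_consistency_def
proof (intro allI impI)
  fix s
  assume "invoked (bartak p_app p) X s"
  then obtain Y where Y: "vars s = X @ Y"
    using invoked_appends by blast
  let ?q = "bartak p_app p"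
  \<comment> \<open>\<open>?L\<close> and \<open>?p\<close> pair the language with its propagator,
    so both phases are treated at once.\<close>
  let ?L = "if is_closed s then C else tightest_contractible_approx C"
  let ?p = "if is_closed s then p (vars s) else p_app (vars s)"
  have q_eq: "?q s = ?p (doms s)"
    by (simp add: bartak_def)
  have propagator: "closed_propagator ?L (vars s) ?p"
    using assms(1,3) Y by simp
  have consistent: "domain_consistent ?L (vars s) (?q s)"
    using assms(2,4) Y unfolding q_eq maintains_domain_consistency_def by simp
  \<comment> \<open>In the closed phase a support in \<open>C\<close> is also one in its
    prefix-closure, taking an empty completion.\<close>
  have "domain_consistent (tightest_contractible_approx C) (vars s) (?q s)"
    using domain_consistent_mono[OF consistent, of "tightest_contractible_approx C"]
      prefix_closure_superset[of C]
    by (simp add: tightest_contractible_approx_def)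
  then have "open_D_consistent C (propagate ?q s)"
    by (intro open_D_consistent_if_approx_domain_consistent) (simp add: propagate_def)
  moreover have "filters (vars s) (doms s) (?q s)"
    using propagator unfolding closed_propagator_def q_eq by blast
  moreover have "solutions ?L (vars s) (doms s) \<subseteq> solutions ?L (vars s) (?q s)"
    using propagator unfolding closed_propagator_def q_eq by blast
  then have "viable C s \<subseteq> viable C (propagate ?q s)"
    unfolding viable_eq_solutions by (simp add: propagate_def)
  ultimately show "filters (vars s) (doms s) (?q s) \<and>
      viable C s \<subseteq> viable C (propagate ?q s) \<and> open_D_consistent C (propagate ?q s)"
    by blast
qed

end
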